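(* For $n\in\mathbb{N}$ let $$D_{n,\Gamma_{n}}(f)(x)=\sum_{k=0}^{n}p_{n,k}(x)\cdot\frac{(C)\int_{0}^{1}f(t)t^{k}(1-t)^{n-k}\,dP_{\lambda_{n,k}}(t)}{(C)\int_{0}^{1}t^{k}(1-t)^{n-k}\,dP_{\lambda_{n,k}}(t)},$$ where $P_{\lambda_{n,k}}$ is the possibility measure on $[0,1]$ induced by the possibility distribution $$\lambda_{n,k}(t)=\frac{t^{k}(1-t)^{n-k}}{k^{k}n^{-n}(n-k)^{n-k}},\qquad t\in[0,1],\ k=0,\dots,n$$ (with the convention $0^{0}=1$). Then for every $f\in C_{+}([0,1])$, $x\in[0,1]$ and $n\in\mathbb{N}$, $n\ge 2$, we have $$|D_{n,\Gamma_{n}}(f)(x)-f(x)|\le 2\,\omega_{1}\left(f;\frac{(1+\sqrt{2})\sqrt{x(1-x)}+\sqrt{2}\sqrt{x}}{\sqrt{n}}+\frac{1}{n}\right)_{[0,1]}.$$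
   Context: $p_{n,k}(x)=\binom{n}{k}x^{k}(1-x)^{n-k}$. $C_{+}([0,1])$ is the set of continuous functions $f:[0,1]\to[0,+\infty)$, and $\omega_{1}(f;\delta)_{[0,1]}=\sup\{|f(t)-f(y)|:t,y\in[0,1],\ |t-y|\le\delta\}$. A possibility distribution on $[0,1]$ is a function $\lambda:[0,1]\to[0,1]$ with $\sup\{\lambda(s):s\in[0,1]\}=1$; it induces the possibility measure $P_{\lambda}(A)=\sup\{\lambda(s):s\in A\}$ for $A\subset[0,1]$, with $P_{\lambda}(\emptyset)=0$. For a monotone set function $\mu$ (i.e. $\mu(\emptyset)=0$ and $\mu(A)\le\mu(B)$ for $A\subset B$) and a nonnegative Borel measurable $f$ on $[0,1]$, the Choquet integral is $(C)\int_{0}^{1}f\,d\mu=\int_{0}^{+\infty}\mu(\{t\in[0,1]:f(t)\ge\beta\})\,d\beta$. Here $\Gamma_{n}=\{P_{\lambda_{n,k}}\}_{k=0}^{n}$. *)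

theory Defs
  imports "HOL-Analysis.Analysis"
begin

definition C_plus :: "(real \<Rightarrow> real) set" where
  "C_plus = {f. continuous_on {0..1} f \<and> (\<forall>t\<in>{0..1}. f t \<ge> 0)}"

definition omega1 :: "(real \<Rightarrow> real) \<Rightarrow> real \<Rightarrow> real" where
  "omega1 f \<delta> = Sup {\<bar>f t - f y\<bar> | t y. t \<in> {0..1} \<and> y \<in> {0..1} \<and> \<bar>t - y\<bar> \<le> \<delta>}"

definition possibility_distribution :: "(real \<Rightarrow> real) \<Rightarrow> bool" where
  "possibility_distribution l \<longleftrightarrow> l ` {0..1} \<subseteq> {0..1} \<and> (SUP s\<in>{0..1}. l s) = 1"

definition possibility_measure :: "(real \<Rightarrow> real) \<Rightarrow> real set \<Rightarrow> real" where
  "possibility_measure l A = (if A = {} then 0 else (SUP s\<in>A. l s))"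

text \<open>The integral on the right is the Lebesgue integral, which for the nonincreasing nonnegative
  integrand agrees with the improper Riemann integral when finite; a divergent one would get the
  value 0. For bounded \<open>f\<close> and real-valued \<open>\<mu>\<close> the integrand is bounded and vanishes for
  large \<open>\<beta>\<close>, so it is integrable.\<close>

definition choquet_integral :: "(real set \<Rightarrow> real) \<Rightarrow> (real \<Rightarrow> real) \<Rightarrow> real" where
  "choquet_integral \<mu> f = (LBINT \<beta>:{0..}. \<mu> {t\<in>{0..1}. f t \<ge> \<beta>})"

definition lam :: "nat \<Rightarrow> nat \<Rightarrow> real \<Rightarrow> real" where
  "lam n k t = t ^ k * (1 - t) ^ (n - k) /
     (real k ^ k * real n powi (- int n) * real (n - k) ^ (n - k))"

lemma possibility_distribution_lam:
  assumes "k \<le> n"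
  shows "possibility_distribution (lam n k)"
proof (cases "n = 0")
  case True
  then show ?thesis using assms by (auto simp: possibility_distribution_def lam_def)
next
  case False
  define m where "m = n - k"
  have n: "n = k + m" using assms by (simp add: m_def)
  have N: "real n > 0" using False by simp
  have aux: "(real n * s) ^ j \<le> real j ^ j * exp (real n * s - real j)" if "0 \<le> s" for s j
  proof (cases "j = 0")
    case True
    then show ?thesis using that by simp
  next
    case False
    have "real n * s / j \<le> exp (real n * s / j - 1)"
      using exp_ge_add_one_self[of "real n * s / j - 1"] by simp
    then have "(real n * s / j) ^ j \<le> exp (real n * s / j - 1) ^ j"
      using that by (intro power_mono) auto
    also have "\<dots> = exp (real n * s - j)"
      using False by (simp add: exp_of_nat_mult[symmetric] right_diff_distrib)
    finally show ?thesis using False by (simp add: power_divide divide_le_eq mult.commute)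
  qed
  define c where "c = real k ^ k * real n powi (- int n) * real m ^ m"
  have c0: "c > 0"
    using N by (cases "k = 0"; cases "m = 0") (auto simp: c_def)
  have cn: "real n ^ n * c = real k ^ k * real m ^ m"
    using N by (simp add: c_def power_int_minus)
  have lam: "lam n k t = t ^ k * (1 - t) ^ m / c" for t
    by (simp add: lam_def c_def m_def)
  have range: "lam n k t \<in> {0..1}" if t: "t \<in> {0..1}" for t
  proof -
    have "real n ^ n * (t ^ k * (1 - t) ^ m) = (real n * t) ^ k * (real n * (1 - t)) ^ m"
      unfolding power_mult_distrib by (subst (2) n) (simp add: power_add)
    also have "\<dots> \<le> (real k ^ k * exp (real n * t - k)) * (real m ^ m * exp (real n * (1 - t) - m))"
      using t by (intro mult_mono aux) auto
    also have "\<dots> = real k ^ k * real m ^ m * exp (real n * t - k + (real n * (1 - t) - m))"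
      by (simp add: exp_add)
    also have "real n * t - k + (real n * (1 - t) - m) = 0" by (simp add: n algebra_simps)
    finally have "real n ^ n * (t ^ k * (1 - t) ^ m) \<le> real n ^ n * c" by (simp add: cn)
    then have "t ^ k * (1 - t) ^ m \<le> c" using N by simp
    then show ?thesis using c0 t by (simp add: lam)
  qed
  have one: "lam n k (k / n) = 1"
  proof -
    have "1 - real k / n = real m / n" using N by (simp add: n field_simps)
    then have "real n ^ n * ((k / n) ^ k * (1 - k / n) ^ m) = real n ^ n * c"
      unfolding cn using N by (subst (1) n) (simp add: power_add power_divide)
    then show ?thesis using N c0 by (simp add: lam)
  qed
  have kn: "real k / n \<in> {0..1}" using N by (simp add: n)
  have "(SUP s\<in>{0..1}. lam n k s) = 1"
    using range kn one by (intro cSup_eq_maximum) (auto intro!: rev_image_eqI)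
  then show ?thesis using range by (auto simp: possibility_distribution_def)
qed

definition D :: "nat \<Rightarrow> (real \<Rightarrow> real) \<Rightarrow> real \<Rightarrow> real" where
  "D n f x = (\<Sum>k=0..n. Bernstein n k x *
     (choquet_integral (possibility_measure (lam n k)) (\<lambda>t. f t * t ^ k * (1 - t) ^ (n - k)) /
      choquet_integral (possibility_measure (lam n k)) (\<lambda>t. t ^ k * (1 - t) ^ (n - k))))"

end

theory Submission
  imports Defs
begin

text \<open>
  Put \<open>w t = t ^ k * (1 - t) ^ (n - k)\<close> and \<open>u = k / n\<close>. The weight \<open>w\<close> is maximal at \<open>u\<close>, and
  \<open>lam n k = w / w u\<close>, so the possibility measure gives mass 1 to every set containing \<open>u\<close> and at
  most 1 to any set. Since the Choquet integral of \<open>g\<close> integrates the masses of the superlevel sets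
  of \<open>g\<close>, it lies between \<open>g u\<close> and the supremum of \<open>g\<close>
  (\<open>choquet_possibility_bounds\<close>). Hence the denominator of the \<open>k\<close>-th quotient is exactly \<open>w u\<close>, and
  the quotient itself lies between \<open>f u\<close> and the supremum of \<open>f * w / w u\<close>.

  Both ends are close to \<open>f x\<close>. For \<open>\<delta> > 0\<close> the modulus of continuity gives
  \<open>\<bar>f t - f x\<bar> \<le> omega1 f \<delta> * (1 + \<bar>t - x\<bar> / \<delta>)\<close>, where \<open>\<bar>t - x\<bar> \<le> \<bar>t - u\<bar> + \<bar>u - x\<bar>\<close>. At the
  lower end \<open>t = u\<close>; at the upper end \<open>\<bar>t - u\<bar>\<close> comes multiplied by \<open>w t / w u\<close>. An interior maximum
  of \<open>\<bar>t - u\<bar> * w t\<close> satisfies \<open>n * (t - u)\<^sup>2 = t * (1 - t)\<close>, which limits that product to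
  \<open>(sqrt (u * (1 - u) / n) + 1 / n) * w u\<close> (\<open>displacement_times_weight_le\<close>).

  It remains to average \<open>\<bar>u - x\<bar> + sqrt (u * (1 - u) / n) + 1 / n\<close> over \<open>k\<close> with the Bernstein
  weights. By the Cauchy-Schwarz inequality and the first two moments of the binomial distribution
  each of the first two terms averages to at most \<open>sqrt (x * (1 - x) / n)\<close>, so the total is at most
  \<open>2 * sqrt (x * (1 - x)) / sqrt n + 1 / n\<close>. Because \<open>2 \<le> 1 + sqrt 2\<close>, this is no more than the
  argument \<open>\<delta>\<close> of the modulus in the theorem, and \<open>1 + \<delta> / \<delta> = 2\<close> is the constant in front.
\<close>

section \<open>Choquet integrals against a possibility measure\<close>

lemma possibility_measure_mono:
  assumes l: "l ` {0..1} \<subseteq> {0..1}" and AB: "A \<subseteq> B" and B: "B \<subseteq> {0..1}"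
  shows "possibility_measure l A \<le> possibility_measure l B"
proof (cases "A = {}")
  case True
  show ?thesis
  proof (cases "B = {}")
    case False
    then obtain b where b: "b \<in> B" by auto
    have "bdd_above (l ` B)" using l B by (intro bdd_aboveI[of _ 1]) force
    then have "l b \<le> (SUP s\<in>B. l s)" using b by (intro cSUP_upper) auto
    moreover have "0 \<le> l b" using l b B by force
    ultimately show ?thesis using True False by (simp add: possibility_measure_def)
  qed (simp add: True)
next
  case False
  have "bdd_above (l ` B)" using l B by (intro bdd_aboveI[of _ 1]) force
  then have "(SUP s\<in>A. l s) \<le> (SUP s\<in>B. l s)" using AB False by (intro cSUP_subset_mono) auto
  then show ?thesis using False AB by (auto simp: possibility_measure_def)
qed

lemma possibility_measure_le_1:
  assumes "l ` {0..1} \<subseteq> {0..1}" and "A \<subseteq> {0..1}"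
  shows "possibility_measure l A \<le> 1"
proof (cases "A = {}")
  case False
  then have "(SUP s\<in>A. l s) \<le> 1" using assms by (intro cSUP_least) force+
  then show ?thesis using False by (simp add: possibility_measure_def)
qed (simp add: possibility_measure_def)

lemma possibility_measure_eq_1:
  assumes l: "l ` {0..1} \<subseteq> {0..1}" and A: "A \<subseteq> {0..1}" and u: "u \<in> A" "l u = 1"
  shows "possibility_measure l A = 1"
proof -
  have "possibility_measure l {u} \<le> possibility_measure l A"
    using u by (intro possibility_measure_mono[OF l _ A]) auto
  then show ?thesis
    using possibility_measure_le_1[OF l A] u by (simp add: possibility_measure_def)
qed

text \<open>The function \<open>\<beta> \<mapsto> P {g \<ge> \<beta>}\<close> is 1 up to \<open>g u\<close>, because those superlevel sets contain the
  point \<open>u\<close> of full possibility, and 0 beyond \<open>S\<close>; in between it takes values in \<open>[0, 1]\<close>. Being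
  monotone it is measurable, and so its integral lies between those of the indicators of
  \<open>{0..g u}\<close> and \<open>{0..S}\<close>.\<close>

lemma choquet_possibility_bounds:
  assumes l: "l ` {0..1} \<subseteq> {0..1}"
    and u: "u \<in> {0..1}" "l u = 1"
    and g: "\<And>t. t \<in> {0..1} \<Longrightarrow> 0 \<le> g t" "\<And>t. t \<in> {0..1} \<Longrightarrow> g t \<le> S"
  shows "g u \<le> choquet_integral (possibility_measure l) g"
    and "choquet_integral (possibility_measure l) g \<le> S"
proof -
  define h where "h \<beta> = possibility_measure l {t\<in>{0..1}. g t \<ge> \<beta>}" for \<beta> :: real
  have h_antimono: "h b \<le> h a" if "a \<le> b" for a b
    unfolding h_def using that by (intro possibility_measure_mono[OF l]) auto
  have h0: "0 \<le> h \<beta>" for \<beta>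
    unfolding h_def using possibility_measure_mono[OF l, of "{}" "{t\<in>{0..1}. g t \<ge> \<beta>}"]
    by (force simp: possibility_measure_def[of l "{}"] intro: order_trans)
  have h1: "h \<beta> \<le> 1" for \<beta>
    unfolding h_def by (intro possibility_measure_le_1[OF l]) auto
  have h_top: "h \<beta> = 0" if "\<beta> > S" for \<beta>
  proof -
    have "{t\<in>{0..1}. g t \<ge> \<beta>} = {}" using g(2) that by fastforce
    then show ?thesis unfolding h_def by (simp only: possibility_measure_def simp_thms if_True)
  qed
  have h_bot: "h \<beta> = 1" if "\<beta> \<le> g u" for \<beta>
    unfolding h_def using u that by (intro possibility_measure_eq_1[OF l, of _ u]) auto
  have S: "0 \<le> S" using g[OF u(1)] by simp
  have upper: "indicator {0..} \<beta> *\<^sub>R h \<beta> \<le> indicator {0..S} \<beta>" for \<beta>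
    using h1 h_top[of \<beta>] by (auto simp: indicator_def)
  have lower: "indicator {0..g u} \<beta> \<le> indicator {0..} \<beta> *\<^sub>R h \<beta>" for \<beta>
    using h0 h_bot[of \<beta>] by (auto simp: indicator_def)
  have int_ind: "integrable lborel (indicator {0..a} :: real \<Rightarrow> real)" for a :: real
    by (rule integrable_real_indicator) (auto simp: emeasure_lborel_Icc_eq)
  have "mono (\<lambda>\<beta>. - h \<beta>)" by (intro monoI) (simp add: h_antimono)
  then have "(\<lambda>\<beta>. - (- h \<beta>)) \<in> borel_measurable borel"
    by (intro borel_measurable_uminus borel_measurable_mono)
  then have [measurable]: "h \<in> borel_measurable borel" by simp
  have int_h: "integrable lborel (\<lambda>\<beta>. indicator {0..} \<beta> *\<^sub>R h \<beta>)"
  proof (rule Bochner_Integration.integrable_bound[OF int_ind[of S]])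
    show "AE \<beta> in lborel. norm (indicator {0..} \<beta> *\<^sub>R h \<beta>) \<le> norm (indicator {0..S} \<beta> :: real)"
      using upper h0 by (intro AE_I2) simp
  qed measurable
  have C: "choquet_integral (possibility_measure l) g = (LBINT \<beta>. indicator {0..} \<beta> *\<^sub>R h \<beta>)"
    by (simp add: choquet_integral_def set_lebesgue_integral_def h_def)
  have "g u = (LBINT \<beta>. indicator {0..g u} \<beta>)" using g(1)[OF u(1)] by simp
  also have "\<dots> \<le> choquet_integral (possibility_measure l) g"
    unfolding C by (intro integral_mono int_ind int_h lower)
  finally show "g u \<le> choquet_integral (possibility_measure l) g" .
  have "choquet_integral (possibility_measure l) g \<le> (LBINT \<beta>. indicator {0..S} \<beta>)"
    unfolding C by (intro integral_mono int_ind int_h upper)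
  also have "\<dots> = S" using S by simp
  finally show "choquet_integral (possibility_measure l) g \<le> S" .
qed

section \<open>The Bernstein weights as possibility distributions\<close>

lemma lam_eq_quotient_by_peak:
  assumes "k \<le> n" and "0 < n"
  shows "lam n k t = t ^ k * (1 - t) ^ (n - k) / ((k / n) ^ k * (1 - k / n) ^ (n - k))"
proof -
  define m where "m = n - k"
  have n: "n = k + m" using assms by (simp add: m_def)
  have "1 - real k / n = real m / n" using assms by (simp add: m_def of_nat_diff field_simps)
  then have "(k / n) ^ k * (1 - k / n) ^ m = real k ^ k * real m ^ m / real n ^ (k + m)"
    by (simp add: power_divide power_add)
  also have "\<dots> = real k ^ k * real n powi (- int n) * real m ^ m"
    by (simp add: power_int_minus n[symmetric] divide_inverse)
  finally show ?thesis by (simp add: lam_def m_def)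
qed

lemma peak_pos:
  assumes "k \<le> n" and "0 < n"
  shows "0 < (real k / n) ^ k * (1 - real k / n) ^ (n - k)"
  using assms by (cases "k = 0"; cases "k = n") auto

lemma weight_le_peak:
  assumes "k \<le> n" and "0 < n" and "t \<in> {0..1}"
  shows "t ^ k * (1 - t) ^ (n - k) \<le> (k / n) ^ k * (1 - k / n) ^ (n - k)"
proof -
  have "lam n k t \<le> 1"
    using possibility_distribution_lam[OF assms(1)] assms(3)
    by (auto simp: possibility_distribution_def image_subset_iff)
  then show ?thesis
    using peak_pos[OF assms(1,2)] by (simp add: lam_eq_quotient_by_peak[OF assms(1,2)])
qed

text \<open>The last hypothesis amounts to \<open>d * (d - 1 / a) \<le> v / a\<close>, and for \<open>d > 1 / a\<close> its left side
  is at least \<open>(d - 1 / a)\<^sup>2\<close>.\<close>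

lemma le_sqrt_plus_inverse:
  fixes d v a :: real
  assumes "0 < a" "0 \<le> v" "0 \<le> d" and "a * d\<^sup>2 \<le> v + d"
  shows "d \<le> sqrt (v / a) + 1 / a"
proof (rule ccontr)
  assume "\<not> d \<le> sqrt (v / a) + 1 / a"
  then have s: "sqrt (v / a) < d - 1 / a" by simp
  then have "d - 1 / a > 0" using assms real_sqrt_ge_zero[of "v / a"] by (meson divide_nonneg_pos le_less_trans)
  then have "v / a < (d - 1 / a) * d"
  proof -
    have "(sqrt (v / a))\<^sup>2 < (d - 1 / a)\<^sup>2" using s assms by (intro power_strict_mono) auto
    also have "\<dots> \<le> (d - 1 / a) * d"
      using \<open>d - 1 / a > 0\<close> assms by (auto simp: power2_eq_square intro!: mult_left_mono)
    finally show ?thesis using assms by simp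
  qed
  then have "v < a * ((d - 1 / a) * d)" using assms by (simp add: divide_less_eq mult.commute)
  also have "\<dots> = a * d\<^sup>2 - d" using assms by (simp add: field_simps power2_eq_square)
  finally show False using assms by simp
qed

text \<open>Let \<open>s\<close> maximise \<open>\<bar>t - u\<bar> * w t\<close>. Since \<open>w s \<le> w u\<close>, a bound for \<open>\<bar>s - u\<bar>\<close> is enough. The
  product vanishes at the endpoints: there \<open>w\<close> is 0, or the endpoint is \<open>u\<close> itself. So \<open>s\<close> may be
  taken in the interior, where the derivative vanishes. Because
  \<open>t * (1 - t) * w' t = - n * (t - u) * w t\<close>, this means \<open>n * (s - u)\<^sup>2 = s * (1 - s)\<close>. As
  \<open>t \<mapsto> t * (1 - t)\<close> is 1-Lipschitz, \<open>d = \<bar>s - u\<bar>\<close> satisfies \<open>n * d\<^sup>2 \<le> u * (1 - u) + d\<close>.\<close>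

lemma displacement_times_weight_le:
  assumes kn: "k \<le> n" and n: "0 < n" and t: "t \<in> {0..1}"
  defines "u \<equiv> real k / real n"
  shows "\<bar>t - u\<bar> * (t ^ k * (1 - t) ^ (n - k)) \<le>
    (sqrt (u * (1 - u) / n) + 1 / n) * (u ^ k * (1 - u) ^ (n - k))"
proof -
  define m where "m = n - k"
  have nkm: "n = k + m" using kn by (simp add: m_def)
  define w where "w s = s ^ k * (1 - s) ^ m" for s :: real
  define g where "g s = (s - u) * w s" for s
  have u01: "0 \<le> u" "u \<le> 1" using kn n by (auto simp: u_def)
  have nu: "real n * u = k" using n by (simp add: u_def)
  have w0: "0 \<le> w s" if "s \<in> {0..1}" for s using that by (simp add: w_def)
  have peak: "w s \<le> w u" if "s \<in> {0..1}" for s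
    using weight_le_peak[OF kn n that] by (simp add: w_def u_def m_def)
  define B where "B = sqrt (u * (1 - u) / n) + 1 / n"
  have B0: "0 \<le> B" using u01 n by (auto simp: B_def)
  have "continuous_on {0..1} (\<lambda>s. \<bar>g s\<bar>)" unfolding g_def w_def by (intro continuous_intros)
  then obtain s where s: "s \<in> {0..1}" and smax: "\<And>r. r \<in> {0..1} \<Longrightarrow> \<bar>g r\<bar> \<le> \<bar>g s\<bar>"
    using continuous_attains_sup[of "{0..1::real}" "\<lambda>s. \<bar>g s\<bar>"] by auto
  have "\<bar>g s\<bar> \<le> B * w u"
  proof (cases "g s = 0")
    case True
    then show ?thesis using B0 w0[of u] u01 by simp
  next
    case False
    have "s \<noteq> 0" using False by (cases "k = 0") (auto simp: g_def w_def u_def)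
    moreover have "s \<noteq> 1"
      using False n by (cases "m = 0") (auto simp: g_def w_def u_def nkm)
    ultimately have s01: "0 < s" "s < 1" using s by auto
    define dg where "dg = w s + (s - u) * (real k * s ^ (k - 1) * (1 - s) ^ m
      - s ^ k * (real m * (1 - s) ^ (m - 1)))"
    have "(g has_real_derivative dg) (at s)"
      unfolding g_def[abs_def] w_def[abs_def] dg_def
      by (auto intro!: derivative_eq_intros simp: algebra_simps)
    \<comment> \<open>The sign turns the maximum of \<open>\<bar>g\<bar>\<close> at \<open>s\<close> into a local maximum of a differentiable function.\<close>
    then have "((\<lambda>r. sgn (g s) * g r) has_real_derivative sgn (g s) * dg) (at s)"
      by (rule DERIV_cmult)
    moreover have "0 < min s (1 - s)" using s01 by simp
    moreover have "\<forall>r. \<bar>s - r\<bar> < min s (1 - s) \<longrightarrow> sgn (g s) * g r \<le> sgn (g s) * g s"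
    proof (intro allI impI)
      fix r assume "\<bar>s - r\<bar> < min s (1 - s)"
      then have "r \<in> {0..1}" by auto
      then have "sgn (g s) * g r \<le> \<bar>g s\<bar>"
        using smax[of r] by (auto simp: sgn_if abs_if split: if_splits)
      then show "sgn (g s) * g r \<le> sgn (g s) * g s"
        using abs_sgn[of "g s"] by (simp add: mult.commute)
    qed
    ultimately have "sgn (g s) * dg = 0" by (rule DERIV_local_max)
    then have "dg = 0" using False by (simp add: sgn_if split: if_splits)
    \<comment> \<open>Multiplying by \<open>s * (1 - s)\<close> restores the lowered exponents, uniformly in the cases \<open>k = 0\<close>
      and \<open>m = 0\<close>.\<close>
    have ks: "s * (real k * s ^ (k - 1)) = k * s ^ k" by (cases k) auto
    have ms: "(1 - s) * (real m * (1 - s) ^ (m - 1)) = m * (1 - s) ^ m" by (cases m) auto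
    have "0 = s * (1 - s) * dg" using \<open>dg = 0\<close> by simp
    also have "\<dots> = s * (1 - s) * w s + (s - u) *
       ((s * (real k * s ^ (k - 1))) * (1 - s) * (1 - s) ^ m
        - s * s ^ k * ((1 - s) * (real m * (1 - s) ^ (m - 1))))"
      by (simp add: dg_def algebra_simps)
    also have "\<dots> = w s * (s * (1 - s) + (s - u) * (k * (1 - s) - m * s))"
      unfolding ks ms by (simp add: w_def algebra_simps)
    also have "k * (1 - s) - m * s = - n * (s - u)"
      using nu by (simp add: nkm algebra_simps)
    finally have "s * (1 - s) + (s - u) * (- n * (s - u)) = 0"
      using False by (simp add: g_def)
    then have "s * (1 - s) = n * (s - u)\<^sup>2" by (simp add: power2_eq_square algebra_simps)
    moreover have "s * (1 - s) \<le> u * (1 - u) + \<bar>s - u\<bar>"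
    proof -
      have "s * (1 - s) - u * (1 - u) = (s - u) * (1 - s - u)" by (simp add: algebra_simps)
      also have "\<dots> \<le> \<bar>s - u\<bar> * \<bar>1 - s - u\<bar>" by (metis abs_ge_self abs_mult)
      also have "\<dots> \<le> \<bar>s - u\<bar> * 1" using s01 u01 by (intro mult_left_mono) auto
      finally show ?thesis by simp
    qed
    ultimately have "\<bar>s - u\<bar> \<le> B"
      unfolding B_def using n u01 by (intro le_sqrt_plus_inverse) auto
    then show ?thesis
      unfolding g_def abs_mult using peak[OF s] w0[OF s] B0 by (intro mult_mono) auto
  qed
  then have "\<bar>g t\<bar> \<le> B * w u" using smax[OF t] by simp
  moreover have "\<bar>g t\<bar> = \<bar>t - u\<bar> * w t" using w0[OF t] by (simp add: g_def abs_mult)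
  ultimately show ?thesis by (simp add: w_def B_def m_def)
qed

section \<open>The modulus of continuity\<close>

lemma omega1_upper:
  assumes f: "continuous_on {0..1} f" and "t \<in> {0..1}" "y \<in> {0..1}" "\<bar>t - y\<bar> \<le> \<delta>"
  shows "\<bar>f t - f y\<bar> \<le> omega1 f \<delta>"
  unfolding omega1_def
proof (rule cSup_upper)
  have "bounded (f ` {0..1})"
    using f by (intro compact_imp_bounded compact_continuous_image) auto
  then obtain M where M: "\<And>t. t \<in> {0..1} \<Longrightarrow> \<bar>f t\<bar> \<le> M" unfolding bounded_iff by force
  have "\<bar>f t - f y\<bar> \<le> M + M" if "t \<in> {0..1}" "y \<in> {0..1}" for t y
    using M[OF that(1)] M[OF that(2)] by linarith
  then show "bdd_above {\<bar>f t - f y\<bar> | t y. t \<in> {0..1} \<and> y \<in> {0..1} \<and> \<bar>t - y\<bar> \<le> \<delta>}"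
    by (intro bdd_aboveI[of _ "M + M"]) blast
qed (use assms in blast)

text \<open>Cut the segment from \<open>y\<close> to \<open>t\<close> into \<open>N\<close> equal steps of length at most \<open>\<delta>\<close>.\<close>

lemma diff_le_multiple_omega1:
  assumes f: "continuous_on {0..1} f" and \<delta>: "0 < \<delta>"
  shows "t \<in> {0..1} \<Longrightarrow> y \<in> {0..1} \<Longrightarrow> \<bar>t - y\<bar> \<le> real N * \<delta> \<Longrightarrow> \<bar>f t - f y\<bar> \<le> real N * omega1 f \<delta>"
proof (induction N arbitrary: t)
  case (Suc N)
  define r where "r = y + (t - y) * N / Suc N"
  define c where "c = real N / real (Suc N)"
  have r: "r = (1 - c) * y + c * t" by (simp add: r_def c_def algebra_simps diff_divide_distrib)
  have "r \<in> {0..1}"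
  proof -
    have "0 \<le> c" "c \<le> 1" by (auto simp: c_def)
    then have "0 \<le> r" "r \<le> 1"
      unfolding r using Suc.prems(1,2) by (auto intro!: convex_bound_le add_nonneg_nonneg)
    then show ?thesis by simp
  qed
  have "t - r = (t - y) / Suc N" by (simp add: r_def field_simps)
  then have "\<bar>t - r\<bar> = \<bar>t - y\<bar> / Suc N" by simp
  also have "\<dots> \<le> \<delta>" using Suc.prems(3) by (simp add: divide_le_eq mult.commute)
  finally have "\<bar>f t - f r\<bar> \<le> omega1 f \<delta>" using \<open>r \<in> _\<close> Suc.prems by (intro omega1_upper[OF f]) auto
  moreover have "\<bar>f r - f y\<bar> \<le> N * omega1 f \<delta>"
  proof (rule Suc.IH)
    have "\<bar>r - y\<bar> = \<bar>t - y\<bar> * (N / Suc N)" by (simp add: r_def abs_mult)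
    also have "\<dots> \<le> (Suc N * \<delta>) * (N / Suc N)" using Suc.prems(3) by (intro mult_right_mono) auto
    also have "\<dots> = N * \<delta>" by (simp add: field_simps)
    finally show "\<bar>r - y\<bar> \<le> N * \<delta>" .
  qed (use \<open>r \<in> _\<close> Suc.prems in auto)
  ultimately show ?case by (simp add: algebra_simps)
qed simp

lemma diff_le_omega1:
  assumes f: "continuous_on {0..1} f" and \<delta>: "0 < \<delta>" and "t \<in> {0..1}" "y \<in> {0..1}"
  shows "\<bar>f t - f y\<bar> \<le> omega1 f \<delta> * (1 + \<bar>t - y\<bar> / \<delta>)"
proof -
  define N where "N = nat \<lceil>\<bar>t - y\<bar> / \<delta>\<rceil>"
  have N: "\<bar>t - y\<bar> / \<delta> \<le> N" "real N \<le> 1 + \<bar>t - y\<bar> / \<delta>"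
    using \<delta> by (auto simp: N_def real_nat_ceiling_ge) linarith
  have "0 \<le> omega1 f \<delta>" using omega1_upper[OF f assms(3) assms(3), of \<delta>] \<delta> by simp
  have "\<bar>f t - f y\<bar> \<le> N * omega1 f \<delta>"
    using N(1) \<delta> assms by (intro diff_le_multiple_omega1[OF f]) (auto simp: divide_le_eq)
  also have "\<dots> \<le> (1 + \<bar>t - y\<bar> / \<delta>) * omega1 f \<delta>"
    using N(2) \<open>0 \<le> omega1 f \<delta>\<close> by (rule mult_right_mono)
  finally show ?thesis by (simp add: mult.commute)
qed

section \<open>The quotients and their Bernstein average\<close>

text \<open>The maximum property of \<open>w\<close> and the bound on \<open>\<bar>t - u\<bar> * w t\<close> turn the pointwise estimate
  \<open>f t \<le> f x + omega1 f \<delta> * (1 + (\<bar>u - x\<bar> + \<bar>t - u\<bar>) / \<delta>)\<close> into an upper bound for \<open>f * w\<close> in which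
  \<open>\<bar>t - u\<bar>\<close> is replaced by \<open>sqrt (u * (1 - u) / n) + 1 / n\<close>. The upper half of
  \<open>choquet_possibility_bounds\<close> passes it on to the quotient.\<close>

lemma choquet_quotient_deviation:
  assumes f: "f \<in> C_plus" and x: "x \<in> {0..1}" and kn: "k \<le> n" and n: "0 < n" and \<delta>: "0 < \<delta>"
  defines "P \<equiv> possibility_measure (lam n k)" and "u \<equiv> real k / real n"
  shows "\<bar>choquet_integral P (\<lambda>t. f t * t ^ k * (1 - t) ^ (n - k)) /
      choquet_integral P (\<lambda>t. t ^ k * (1 - t) ^ (n - k)) - f x\<bar>
    \<le> omega1 f \<delta> * (1 + (\<bar>u - x\<bar> + (sqrt (u * (1 - u) / n) + 1 / n)) / \<delta>)"
proof -
  define w where "w t = t ^ k * (1 - t) ^ (n - k)" for t :: real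
  define \<omega> where "\<omega> = omega1 f \<delta>"
  define B where "B = sqrt (u * (1 - u) / n) + 1 / n"
  have cont: "continuous_on {0..1} f" and f0: "\<And>t. t \<in> {0..1} \<Longrightarrow> 0 \<le> f t"
    using f by (auto simp: C_plus_def)
  have u: "u \<in> {0..1}" using kn n by (auto simp: u_def)
  then have u': "0 \<le> u" "u \<le> 1" by auto
  have B0: "0 \<le> B" using u' n by (auto simp: B_def)
  have \<omega>0: "0 \<le> \<omega>" using omega1_upper[OF cont u u, of \<delta>] \<delta> by (simp add: \<omega>_def)
  have l: "lam n k ` {0..1} \<subseteq> {0..1}"
    using possibility_distribution_lam[OF kn] by (simp add: possibility_distribution_def)
  have wu: "0 < w u" using peak_pos[OF kn n] by (simp add: w_def u_def)
  have "lam n k u = w u / w u"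
    by (simp only: lam_eq_quotient_by_peak[OF kn n] w_def u_def)
  then have lu: "lam n k u = 1" using wu by simp
  have w0: "0 \<le> w t" if "t \<in> {0..1}" for t using that by (simp add: w_def)
  have peak: "w t \<le> w u" if "t \<in> {0..1}" for t
    using weight_le_peak[OF kn n that] by (simp add: w_def u_def)
  have disp: "\<bar>t - u\<bar> * w t \<le> B * w u" if "t \<in> {0..1}" for t
    using displacement_times_weight_le[OF kn n that] by (simp add: w_def u_def B_def)
  have denom: "choquet_integral P w = w u"
    unfolding P_def using choquet_possibility_bounds[OF l u lu, of w "w u"] w0 peak by force
  define S where "S = f x + \<omega> * (1 + (\<bar>u - x\<bar> + B) / \<delta>)"
  have S: "f t * w t \<le> S * w u" if t: "t \<in> {0..1}" for t
  proof -
    have "f t \<le> f x + \<omega> * (1 + \<bar>t - x\<bar> / \<delta>)"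
      using diff_le_omega1[OF cont \<delta> t x] by (simp add: \<omega>_def)
    also have "\<dots> \<le> f x + \<omega> * (1 + (\<bar>u - x\<bar> + \<bar>t - u\<bar>) / \<delta>)"
      using \<omega>0 \<delta> by (intro add_left_mono mult_left_mono divide_right_mono) auto
    finally have "f t * w t \<le> (f x + \<omega> * (1 + (\<bar>u - x\<bar> + \<bar>t - u\<bar>) / \<delta>)) * w t"
      using w0[OF t] by (rule mult_right_mono)
    also have "\<dots> = (f x + \<omega> * (1 + \<bar>u - x\<bar> / \<delta>)) * w t + \<omega> / \<delta> * (\<bar>t - u\<bar> * w t)"
      by (simp add: algebra_simps add_divide_distrib)
    also have "\<dots> \<le> (f x + \<omega> * (1 + \<bar>u - x\<bar> / \<delta>)) * w u + \<omega> / \<delta> * (B * w u)"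
      using f0[OF x] \<omega>0 \<delta> by (intro add_mono mult_left_mono peak disp t) auto
    also have "\<dots> = S * w u" by (simp add: S_def algebra_simps add_divide_distrib)
    finally show ?thesis .
  qed
  have num: "f u * w u \<le> choquet_integral P (\<lambda>t. f t * w t)"
    "choquet_integral P (\<lambda>t. f t * w t) \<le> S * w u"
    unfolding P_def
    using choquet_possibility_bounds[OF l u lu, of "\<lambda>t. f t * w t" "S * w u"] w0 f0 S by auto
  define q where "q = choquet_integral P (\<lambda>t. f t * w t) / choquet_integral P w"
  have q: "f u \<le> q" "q \<le> S" using num wu by (simp_all add: q_def denom field_simps)
  have "f x - f u \<le> \<omega> * (1 + \<bar>u - x\<bar> / \<delta>)"
    using diff_le_omega1[OF cont \<delta> u x] by (simp add: \<omega>_def)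
  also have "\<dots> \<le> \<omega> * (1 + (\<bar>u - x\<bar> + B) / \<delta>)"
    using \<omega>0 \<delta> B0 by (intro mult_left_mono add_left_mono divide_right_mono) auto
  finally have "\<bar>q - f x\<bar> \<le> \<omega> * (1 + (\<bar>u - x\<bar> + B) / \<delta>)" using q by (simp add: S_def)
  then show ?thesis by (simp add: q_def w_def[abs_def] \<omega>_def B_def mult.assoc)
qed

text \<open>The variance of \<open>a\<close> under the weights \<open>p\<close> is nonnegative.\<close>

lemma weighted_mean_le_root_mean_square:
  fixes p a :: "'i \<Rightarrow> real"
  assumes "finite I" and p: "\<And>i. i \<in> I \<Longrightarrow> 0 \<le> p i" and p1: "(\<Sum>i\<in>I. p i) = 1"
    and V: "(\<Sum>i\<in>I. p i * (a i)\<^sup>2) \<le> V"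
  shows "(\<Sum>i\<in>I. p i * a i) \<le> sqrt V"
proof -
  define m where "m = (\<Sum>i\<in>I. p i * a i)"
  have "0 \<le> (\<Sum>i\<in>I. p i * (a i - m)\<^sup>2)" using p by (intro sum_nonneg) auto
  also have "\<dots> = (\<Sum>i\<in>I. p i * (a i)\<^sup>2 - 2 * m * (p i * a i) + m\<^sup>2 * p i)"
    by (intro sum.cong) (auto simp: power2_eq_square algebra_simps)
  also have "\<dots> = (\<Sum>i\<in>I. p i * (a i)\<^sup>2) - 2 * m * m + m\<^sup>2"
    by (simp add: sum.distrib sum_subtractf sum_distrib_left[symmetric] p1 m_def[symmetric])
  finally have "m\<^sup>2 \<le> V" using V by (simp add: power2_eq_square)
  then show ?thesis unfolding m_def[symmetric] by (rule real_le_rsqrt)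
qed

lemma Bernstein_second_moment:
  assumes "0 < n"
  shows "(\<Sum>k\<le>n. Bernstein n k x * (real k / n)\<^sup>2) = x\<^sup>2 + x * (1 - x) / n"
proof -
  have "(\<Sum>k\<le>n. Bernstein n k x * (real k / n)\<^sup>2)
      = (\<Sum>k\<le>n. real k * (real k - 1) * Bernstein n k x + k * Bernstein n k x) / n\<^sup>2"
    unfolding sum_divide_distrib using assms
    by (intro sum.cong) (auto simp: field_simps power2_eq_square)
  also have "\<dots> = (real n * (real n - 1) * x\<^sup>2 + n * x) / n\<^sup>2"
    by (simp only: sum.distrib sum_kk_Bernstein sum_k_Bernstein)
  also have "\<dots> = x\<^sup>2 + x * (1 - x) / n" using assms by (simp add: field_simps power2_eq_square)
  finally show ?thesis .
qed

lemma Bernstein_first_moment: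
  assumes "0 < n"
  shows "(\<Sum>k\<le>n. Bernstein n k x * (real k / n)) = x"
proof -
  have "(\<Sum>k\<le>n. Bernstein n k x * (real k / n)) = (\<Sum>k\<le>n. k * Bernstein n k x) / n"
    unfolding sum_divide_distrib by (intro sum.cong) (auto simp: mult.commute)
  also have "\<dots> = x" using assms by (simp add: sum_k_Bernstein)
  finally show ?thesis .
qed

lemma Bernstein_mean_distance:
  assumes n: "0 < n" and x: "0 \<le> x" "x \<le> 1"
  shows "(\<Sum>k\<le>n. Bernstein n k x * \<bar>real k / n - x\<bar>) \<le> sqrt (x * (1 - x) / n)"
proof (rule weighted_mean_le_root_mean_square)
  have "(\<Sum>k\<le>n. Bernstein n k x * \<bar>real k / n - x\<bar>\<^sup>2)
    = (\<Sum>k\<le>n. Bernstein n k x * (real k / n)\<^sup>2 - 2 * x * (Bernstein n k x * (real k / n))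
        + x\<^sup>2 * Bernstein n k x)"
    by (intro sum.cong) (auto simp: power2_eq_square algebra_simps)
  also have "\<dots> = x * (1 - x) / n"
    by (simp only: sum.distrib sum_subtractf sum_distrib_left[symmetric]
        Bernstein_second_moment[OF n] Bernstein_first_moment[OF n] sum_Bernstein)
       (simp add: power2_eq_square)
  finally show "(\<Sum>k\<le>n. Bernstein n k x * \<bar>real k / n - x\<bar>\<^sup>2) \<le> x * (1 - x) / n" by simp
qed (use x in \<open>auto intro: Bernstein_nonneg\<close>)

text \<open>By the two moments, the average of \<open>u * (1 - u)\<close> over \<open>u = k / n\<close> is
  \<open>(1 - 1 / n) * x * (1 - x)\<close>.\<close>

lemma Bernstein_mean_spread:
  assumes n: "0 < n" and x: "0 \<le> x" "x \<le> 1"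
  shows "(\<Sum>k\<le>n. Bernstein n k x * sqrt (real k / n * (1 - real k / n) / n)) \<le> sqrt (x * (1 - x) / n)"
proof (rule weighted_mean_le_root_mean_square)
  have "(\<Sum>k\<le>n. Bernstein n k x * (sqrt (real k / n * (1 - real k / n) / n))\<^sup>2)
    = (\<Sum>k\<le>n. Bernstein n k x * (real k / n) - Bernstein n k x * (real k / n)\<^sup>2) / n"
    unfolding sum_divide_distrib
  proof (intro sum.cong refl)
    fix k assume "k \<in> {..n}"
    then have "0 \<le> real k / n * (1 - real k / n) / n"
      using n by (intro divide_nonneg_nonneg mult_nonneg_nonneg) auto
    then show "Bernstein n k x * (sqrt (real k / n * (1 - real k / n) / n))\<^sup>2
      = (Bernstein n k x * (real k / n) - Bernstein n k x * (real k / n)\<^sup>2) / n"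
      by (simp only: real_sqrt_pow2) (simp add: power2_eq_square algebra_simps diff_divide_distrib)
  qed
  also have "\<dots> = (x * (1 - x) - x * (1 - x) / n) / n"
    by (simp only: sum_subtractf Bernstein_second_moment[OF n] Bernstein_first_moment[OF n])
       (simp add: power2_eq_square algebra_simps)
  also have "\<dots> \<le> x * (1 - x) / n" using x by (intro divide_right_mono) auto
  finally show "(\<Sum>k\<le>n. Bernstein n k x * (sqrt (real k / n * (1 - real k / n) / n))\<^sup>2)
    \<le> x * (1 - x) / n" .
qed (use x in \<open>auto intro: Bernstein_nonneg\<close>)

theorem theorem4p1:
  fixes f :: "real \<Rightarrow> real" and x :: real and n :: nat
  assumes "f \<in> C_plus" and "x \<in> {0..1}" and "n \<ge> 2"
  shows "\<bar>D n f x - f x\<bar> \<le>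
    2 * omega1 f (((1 + sqrt 2) * sqrt (x * (1 - x)) + sqrt 2 * sqrt x) / sqrt (real n) + 1 / real n)"
proof -
  define \<delta> where "\<delta> = ((1 + sqrt 2) * sqrt (x * (1 - x)) + sqrt 2 * sqrt x) / sqrt n + 1 / n"
  define \<omega> where "\<omega> = omega1 f \<delta>"
  define p where "p k = Bernstein n k x" for k
  define q where "q k = choquet_integral (possibility_measure (lam n k)) (\<lambda>t. f t * t ^ k * (1 - t) ^ (n - k)) /
      choquet_integral (possibility_measure (lam n k)) (\<lambda>t. t ^ k * (1 - t) ^ (n - k))" for k
  define b where "b k = \<bar>real k / n - x\<bar> + (sqrt (real k / n * (1 - real k / n) / n) + 1 / n)" for k
  have n: "0 < n" and x: "0 \<le> x" "x \<le> 1" using assms by auto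
  have \<delta>: "0 < \<delta>"
    unfolding \<delta>_def using n x by (intro add_nonneg_pos divide_nonneg_nonneg add_nonneg_nonneg) auto
  have cont: "continuous_on {0..1} f" using assms(1) by (simp add: C_plus_def)
  have \<omega>0: "0 \<le> \<omega>" using omega1_upper[OF cont assms(2) assms(2), of \<delta>] \<delta> by (simp add: \<omega>_def)
  have p0: "0 \<le> p k" for k using x by (simp add: p_def Bernstein_nonneg)
  have p1: "(\<Sum>k\<le>n. p k) = 1" by (simp add: p_def)
  have "(\<Sum>k\<le>n. p k * b k) = (\<Sum>k\<le>n. p k * \<bar>real k / n - x\<bar>)
      + (\<Sum>k\<le>n. p k * sqrt (real k / n * (1 - real k / n) / n)) + (\<Sum>k\<le>n. p k) / n"
    by (simp add: b_def distrib_left sum.distrib sum_divide_distrib)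
  also have "\<dots> \<le> sqrt (x * (1 - x) / n) + sqrt (x * (1 - x) / n) + 1 / n"
    unfolding p1 using n x unfolding p_def
    by (intro add_mono Bernstein_mean_distance Bernstein_mean_spread) auto
  also have "\<dots> = 2 * sqrt (x * (1 - x)) / sqrt n + 1 / n" by (simp add: real_sqrt_divide)
  also have "\<dots> \<le> \<delta>"
  proof -
    have "2 * sqrt (x * (1 - x)) \<le> (1 + sqrt 2) * sqrt (x * (1 - x))"
      using x by (intro mult_right_mono) auto
    moreover have "0 \<le> sqrt 2 * sqrt x" using x by simp
    ultimately show ?thesis
      unfolding \<delta>_def using n by (intro add_right_mono divide_right_mono) auto
  qed
  finally have mean: "(\<Sum>k\<le>n. p k * b k) \<le> \<delta>" .
  have "D n f x - f x = (\<Sum>k\<le>n. p k * q k) - (\<Sum>k\<le>n. p k) * f x"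
    by (simp add: D_def p_def q_def atLeast0AtMost)
  also have "\<dots> = (\<Sum>k\<le>n. p k * (q k - f x))"
    by (simp add: sum_distrib_right sum_subtractf right_diff_distrib)
  finally have "\<bar>D n f x - f x\<bar> \<le> (\<Sum>k\<le>n. \<bar>p k * (q k - f x)\<bar>)" by (simp add: sum_abs)
  also have "\<dots> \<le> (\<Sum>k\<le>n. p k * (\<omega> * (1 + b k / \<delta>)))"
    unfolding abs_mult abs_of_nonneg[OF p0] q_def b_def \<omega>_def
    by (intro sum_mono mult_left_mono choquet_quotient_deviation assms n \<delta> p0) auto
  also have "\<dots> = \<omega> * (\<Sum>k\<le>n. p k) + \<omega> / \<delta> * (\<Sum>k\<le>n. p k * b k)"
    by (simp add: sum_distrib_left sum.distrib[symmetric] algebra_simps)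
  also have "\<dots> \<le> \<omega> * 1 + \<omega> / \<delta> * \<delta>"
    unfolding p1 using \<omega>0 \<delta> mean by (intro add_mono mult_left_mono) auto
  also have "\<dots> = 2 * \<omega>" using \<delta> by simp
  finally show ?thesis by (simp add: \<omega>_def \<delta>_def)
qed

end
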